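(* Let $0<a<b$ and $A=\{x\in\mathbb{R}^2 : a<|x|<b\}$. For $p>1$ let $u_p(x)=u_p(r)$, $r=|x|$, be the unique radially symmetric solution of $$-\Delta u=\frac{u^p(x)}{|x|^2}\ (x\in A),\qquad u(x)>0\ (x\in A),\qquad u(x)=0\ (x\in\partial A).$$ Define $\varepsilon_p>0$ by $p\,\varepsilon_p^2\,\|u_p\|_{L^\infty(A)}^{p-1}=1$ and define $$\tilde u_p(t)=\frac{p}{\|u_p\|_{L^\infty(A)}}\left\{u_p\left(e^{-\left(\varepsilon_p t-\frac{\log(ab)}{2}\right)}\right)-\|u_p\|_{L^\infty(A)}\right\},\qquad t\in I_p=\left(-\frac{\log b-\log a}{2\varepsilon_p},\ \frac{\log b-\log a}{2\varepsilon_p}\right).$$ Then, as $p\to\infty$, $\varepsilon_p\to 0$ and $$\tilde u_p(t)\to U(t)=\log\frac{4e^{\sqrt2\,t}}{(1+e^{\sqrt2\,t})^2}\quad\text{in } C^1_{loc}(\mathbb{R}).$$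
   Context: Let $0<a<b$ and $A=\{x\in\mathbb{R}^2 : a<|x|<b\}$. For every $p>1$ the boundary value problem $$-\Delta u=\frac{u^p(x)}{|x|^2}\ (x\in A),\qquad u(x)>0\ (x\in A),\qquad u(x)=0\ (x\in\partial A)$$ has exactly one radially symmetric solution $u_p$ (solutions are understood in the classical sense, $u\in C^2(A)\cap C^0(\overline{A})$); it is identified with a function of $r=|x|\in[a,b]$. Convergence in $C^1_{loc}(\mathbb{R})$ means: for every compact $K\subset\mathbb{R}$, $K\subset I_p$ for all sufficiently large $p$, and $\tilde u_p\to U$, $\tilde u_p'\to U'$ uniformly on $K$. *)

theory Defs
  imports "HOL-Analysis.Analysis" "HOL-Probability.Essential_Supremum"
begin

definition annulus :: "real \<Rightarrow> real \<Rightarrow> (real^2) set" where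
  "annulus a b = {x. a < norm x \<and> norm x < b}"

definition partial_deriv :: "'n::finite \<Rightarrow> (real^'n \<Rightarrow> real) \<Rightarrow> real^'n \<Rightarrow> real" where
  "partial_deriv i f x = deriv (\<lambda>t. f (x + t *\<^sub>R axis i 1)) 0"

text \<open>The predicates \<open>C1_on\<close> and \<open>C2_on\<close> are meant for open sets. Existence of the partial
  derivatives is required explicitly, since \<^const>\<open>deriv\<close> is total.\<close>

definition C1_on :: "(real^'n::finite) set \<Rightarrow> (real^'n \<Rightarrow> real) \<Rightarrow> bool" where
  "C1_on S f \<longleftrightarrow> continuous_on S f \<and>
     (\<forall>i. (\<forall>x\<in>S. (\<lambda>t. f (x + t *\<^sub>R axis i 1)) differentiable (at 0)) \<and>
          continuous_on S (partial_deriv i f))"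

definition C2_on :: "(real^'n::finite) set \<Rightarrow> (real^'n \<Rightarrow> real) \<Rightarrow> bool" where
  "C2_on S f \<longleftrightarrow> C1_on S f \<and> (\<forall>i. C1_on S (partial_deriv i f))"

definition laplacian :: "(real^'n::finite \<Rightarrow> real) \<Rightarrow> real^'n \<Rightarrow> real" where
  "laplacian f x = (\<Sum>i\<in>UNIV. partial_deriv i (partial_deriv i f) x)"

definition radially_symmetric_on :: "(real^2) set \<Rightarrow> (real^2 \<Rightarrow> real) \<Rightarrow> bool" where
  "radially_symmetric_on S f \<longleftrightarrow> (\<forall>x\<in>S. \<forall>y\<in>S. norm x = norm y \<longrightarrow> f x = f y)"

definition radial_solution :: "real \<Rightarrow> real \<Rightarrow> real \<Rightarrow> (real^2 \<Rightarrow> real) \<Rightarrow> bool" where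
  "radial_solution a b p u \<longleftrightarrow>
     C2_on (annulus a b) u \<and>
     continuous_on (closure (annulus a b)) u \<and>
     radially_symmetric_on (closure (annulus a b)) u \<and>
     (\<forall>x\<in>annulus a b. - laplacian u x = (u x powr p) / (norm x)\<^sup>2) \<and>
     (\<forall>x\<in>annulus a b. u x > 0) \<and>
     (\<forall>x\<in>frontier (annulus a b). u x = 0)"

text \<open>A radially symmetric function on the plane read as a function of the radius \<open>r \<ge> 0\<close>, by
  evaluating it at \<open>(r, 0)\<close>.\<close>

definition radial_profile :: "(real^2 \<Rightarrow> real) \<Rightarrow> real \<Rightarrow> real" where
  "radial_profile u r = u (r *\<^sub>R axis 1 1)"

text \<open>The \<open>L\<^sup>\<infinity>\<close> norm for Lebesgue measure on \<open>S\<close>. The coercion from \<^typ>\<open>ereal\<close> sends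
  infinite values to 0; continuous functions on a compact closure are essentially bounded.\<close>

definition Linf_norm :: "'a::euclidean_space set \<Rightarrow> ('a \<Rightarrow> real) \<Rightarrow> real" where
  "Linf_norm S f = real_of_ereal (esssup (lebesgue_on S) (\<lambda>x. ereal \<bar>f x\<bar>))"

definition rescaled ::
  "real \<Rightarrow> real \<Rightarrow> real \<Rightarrow> real \<Rightarrow> (real^2 \<Rightarrow> real) \<Rightarrow> real \<Rightarrow> real" where
  "rescaled a b p e u t =
     p / Linf_norm (annulus a b) u *
       (radial_profile u (exp (- (e * t - ln (a * b) / 2))) - Linf_norm (annulus a b) u)"

definition rescaled_interval :: "real \<Rightarrow> real \<Rightarrow> real \<Rightarrow> real set" where
  "rescaled_interval a b e = {- ((ln b - ln a) / (2 * e)) <..< (ln b - ln a) / (2 * e)}"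

text \<open>Local \<open>C\<^sup>1\<close> convergence on the real line of functions \<open>f p\<close> that are only meaningful on
  subsets \<open>I p\<close> exhausting the line.\<close>

definition C1_loc_tendsto ::
  "('p \<Rightarrow> real set) \<Rightarrow> ('p \<Rightarrow> real \<Rightarrow> real) \<Rightarrow> (real \<Rightarrow> real) \<Rightarrow> 'p filter \<Rightarrow> bool" where
  "C1_loc_tendsto I f g F \<longleftrightarrow>
     (\<forall>\<^sub>F p in F. f p C1_differentiable_on I p) \<and>
     g C1_differentiable_on UNIV \<and>
     (\<forall>K. compact K \<longrightarrow>
        (\<forall>\<^sub>F p in F. K \<subseteq> I p) \<and>
        uniform_limit K f g F \<and>
        uniform_limit K (\<lambda>p. deriv (f p)) (deriv g) F)"

end

theory Submission
  imports Defs
begin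

text \<open>The substitution \<open>r = exp (c - s)\<close> with \<open>c = ln (a * b) / 2\<close> turns the radial Laplacian
\<open>\<phi>'' + \<phi>' / r\<close> into \<open>w'' / r\<^sup>2\<close>, so the weight \<open>1 / |x|\<^sup>2\<close> cancels and the problem becomes
the autonomous equation \<open>w'' = - w powr p\<close> on the symmetric interval \<open>(-L, L)\<close>,
\<open>L = (ln b - ln a) / 2\<close>, with zero boundary values. By uniqueness for the initial value problem
\<open>w\<close> is even about its maximum point. Since \<open>w\<close> vanishes exactly at the two ends, that
point is the centre (\<open>emden_dirichlet_max_at_centre\<close>). Hence the rescaled function \<open>v\<close> solves
\<open>v'' = - (1 + v / p) powr p\<close> with \<open>v 0 = v' 0 = 0\<close> on \<open>|t| < T = L / \<epsilon>\<close>
(\<open>rescaled_solution_emden\<close>).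

Energy conservation gives \<open>|v'| \<le> sqrt 2\<close> uniformly in \<open>p\<close>. As \<open>v\<close> has to fall from 0 to
\<open>- p\<close> between the centre and the end of the interval, \<open>p \<le> sqrt 2 * T\<close>
(\<open>emden_lifespan_ge\<close>). This is \<open>\<epsilon> \<le> sqrt 2 * L / p\<close>, and it also shows that the
intervals exhaust the line.

Finally \<open>(1 + v / p) powr p\<close> differs from \<open>exp v\<close> by at most \<open>v\<^sup>2 / p\<close>, which is \<open>O(1 / p)\<close>
on compact sets. So \<open>v\<close> almost solves the Liouville equation \<open>U'' = - exp U\<close>, whose solution with
zero initial data is the stated limit, and a Gronwall estimate bounds \<open>v - U\<close> and \<open>v' - U'\<close> by
\<open>O(1 / p)\<close> locally (\<open>emden_solution_near_liouville\<close>).\<close>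

section \<open>A Gronwall estimate for second-order equations\<close>

text \<open>With \<open>e = d\<^sup>2 + d'\<^sup>2\<close>, Young's inequality gives \<open>e' \<le> (2 + K) * e + \<delta>\<^sup>2\<close>: the terms
\<open>2 * d * d'\<close>, \<open>2 * K * |d| * |d'|\<close> and \<open>2 * \<delta> * |d'|\<close> are at most \<open>e\<close>, \<open>K * e\<close> and \<open>e + \<delta>\<^sup>2\<close>.
For \<open>\<delta> = 0\<close> the estimate is uniqueness for the initial value problem; for small \<open>\<delta>\<close> it is
stability under a perturbation of the equation.\<close>

lemma gronwall_second_order_nonneg:
  fixes d d' d'' :: "real \<Rightarrow> real"
  assumes "0 \<le> t" and "0 \<le> K"
    and d: "\<And>s. s \<in> {0..t} \<Longrightarrow> (d has_real_derivative d' s) (at s)"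
    and d': "\<And>s. s \<in> {0..t} \<Longrightarrow> (d' has_real_derivative d'' s) (at s)"
    and bound: "\<And>s. s \<in> {0..t} \<Longrightarrow> \<bar>d'' s\<bar> \<le> K * \<bar>d s\<bar> + \<delta>"
    and init: "d 0 = 0" "d' 0 = 0"
  shows "(d t)\<^sup>2 + (d' t)\<^sup>2 \<le> \<delta>\<^sup>2 * exp ((2 + K) * t)"
proof -
  let ?e = "\<lambda>s. (d s)\<^sup>2 + (d' s)\<^sup>2"
  \<comment> \<open>Since \<open>2 + K \<ge> 1\<close>, the derivative of \<open>e + \<delta>\<^sup>2\<close> is at most \<open>(2 + K) * (e + \<delta>\<^sup>2)\<close>, which the factor compensates.\<close>
  let ?E = "\<lambda>s. (?e s + \<delta>\<^sup>2) * exp (- (2 + K) * s)"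
  have "?E t \<le> ?E 0"
  proof (rule DERIV_nonpos_imp_nonincreasing[OF \<open>0 \<le> t\<close>])
    fix s assume s: "0 \<le> s" "s \<le> t"
    let ?D = "(2 * d s * d' s + 2 * d' s * d'' s - (2 + K) * (?e s + \<delta>\<^sup>2)) * exp (- (2 + K) * s)"
    have "(?E has_real_derivative ?D) (at s)"
      using s by (auto intro!: derivative_eq_intros d d' simp: algebra_simps power2_eq_square)
    moreover have "?D \<le> 0"
    proof -
      have "\<bar>d' s * d'' s\<bar> \<le> \<bar>d' s\<bar> * (K * \<bar>d s\<bar> + \<delta>)"
        using bound[of s] s by (simp add: abs_mult mult_left_mono)
      then have 1: "d' s * d'' s \<le> K * (\<bar>d s\<bar> * \<bar>d' s\<bar>) + \<bar>d' s\<bar> * \<delta>"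
        by (simp add: algebra_simps)
      have 2: "2 * (\<bar>d s\<bar> * \<bar>d' s\<bar>) \<le> ?e s"
        using sum_squares_bound[of "\<bar>d s\<bar>" "\<bar>d' s\<bar>"] by simp
      have 3: "2 * (\<bar>d' s\<bar> * \<delta>) \<le> (d' s)\<^sup>2 + \<delta>\<^sup>2"
        using sum_squares_bound[of "\<bar>d' s\<bar>" \<delta>] by simp
      have 4: "d s * d' s \<le> \<bar>d s\<bar> * \<bar>d' s\<bar>"
        by (metis abs_ge_self abs_mult)
      have 5: "K * (2 * (\<bar>d s\<bar> * \<bar>d' s\<bar>)) \<le> K * ?e s"
        using mult_left_mono[OF 2 \<open>0 \<le> K\<close>] .
      have 6: "0 \<le> K * \<delta>\<^sup>2" "0 \<le> (d' s)\<^sup>2" "0 \<le> (d s)\<^sup>2" "0 \<le> \<delta>\<^sup>2" using \<open>0 \<le> K\<close> by simp_all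
      have "2 * d s * d' s + 2 * d' s * d'' s \<le> (2 + K) * (?e s + \<delta>\<^sup>2)"
        using 1 2 3 4 5 6 unfolding distrib_left distrib_right by linarith
      then show ?thesis by (simp add: mult_le_0_iff)
    qed
    ultimately show "\<exists>y. (?E has_real_derivative y) (at s) \<and> y \<le> 0" by blast
  qed
  then have "?e t + \<delta>\<^sup>2 \<le> \<delta>\<^sup>2 * exp ((2 + K) * t)"
  proof -
    assume "?E t \<le> ?E 0"
    then have "?E t * exp ((2 + K) * t) \<le> \<delta>\<^sup>2 * exp ((2 + K) * t)"
      using init by (intro mult_right_mono) auto
    moreover have "exp (- (2 + K) * t) * exp ((2 + K) * t) = 1"
      by (simp add: algebra_simps flip: exp_add)
    ultimately show ?thesis by (simp only: mult.assoc mult_1_right)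
  qed
  then show ?thesis using zero_le_power2[of \<delta>] by linarith
qed

lemma gronwall_second_order:
  fixes d d' d'' :: "real \<Rightarrow> real"
  assumes "0 \<le> K"
    and d: "\<And>s. \<bar>s\<bar> \<le> \<bar>t\<bar> \<Longrightarrow> (d has_real_derivative d' s) (at s)"
    and d': "\<And>s. \<bar>s\<bar> \<le> \<bar>t\<bar> \<Longrightarrow> (d' has_real_derivative d'' s) (at s)"
    and bound: "\<And>s. \<bar>s\<bar> \<le> \<bar>t\<bar> \<Longrightarrow> \<bar>d'' s\<bar> \<le> K * \<bar>d s\<bar> + \<delta>"
    and init: "d 0 = 0" "d' 0 = 0"
  shows "(d t)\<^sup>2 + (d' t)\<^sup>2 \<le> \<delta>\<^sup>2 * exp ((2 + K) * \<bar>t\<bar>)"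
proof (cases "0 \<le> t")
  case True
  then show ?thesis
    using gronwall_second_order_nonneg[of t K d d' d'' \<delta>] assms by simp
next
  case False
  have "(d (- (- t)))\<^sup>2 + (- d' (- (- t)))\<^sup>2 \<le> \<delta>\<^sup>2 * exp ((2 + K) * (- t))"
  proof (rule gronwall_second_order_nonneg[where d'' = "\<lambda>s. d'' (- s)"])
    fix s assume s: "s \<in> {0..- t}"
    show "((\<lambda>s. d (- s)) has_real_derivative - d' (- s)) (at s)"
      using d[of "- s"] s by (subst DERIV_mirror[symmetric]) auto
    have "((\<lambda>s. d' (- s)) has_real_derivative - d'' (- s)) (at s)"
      using d'[of "- s"] s by (subst DERIV_mirror[symmetric]) auto
    from DERIV_minus[OF this]
    show "((\<lambda>s. - d' (- s)) has_real_derivative d'' (- s)) (at s)" by simp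
    show "\<bar>d'' (- s)\<bar> \<le> K * \<bar>d (- s)\<bar> + \<delta>" using bound[of "- s"] s by auto
  qed (use False assms in auto)
  then show ?thesis using False by simp
qed

section \<open>Comparison with the Liouville equation\<close>

lemma powr_Lipschitz:
  fixes p M x y :: real
  assumes "1 \<le> p" "x \<in> {0<..M}" "y \<in> {0<..M}"
  shows "\<bar>x powr p - y powr p\<bar> \<le> p * M powr (p - 1) * \<bar>x - y\<bar>"
proof -
  have "norm (x powr p - y powr p) \<le> p * M powr (p - 1) * norm (x - y)"
  proof (rule field_differentiable_bound[where S = "{0<..M}" and f' = "\<lambda>z. p * z powr (p - 1)"])
    fix z assume "z \<in> {0<..M}"
    then show "((\<lambda>z. z powr p) has_field_derivative p * z powr (p - 1)) (at z within {0<..M})"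
      by (auto intro: has_field_derivative_at_within has_real_derivative_powr)
    show "norm (p * z powr (p - 1)) \<le> p * M powr (p - 1)"
      using \<open>z \<in> _\<close> assms by (auto simp: abs_mult intro!: mult_left_mono powr_mono2)
  qed (use assms in auto)
  then show ?thesis by simp
qed

text \<open>Both terms are \<open>p\<close>-th powers of numbers in \<open>(0, 1]\<close>, namely of \<open>exp z\<close> and \<open>1 + z\<close> with \<open>z = v / p\<close>.
These differ by at most \<open>z\<^sup>2\<close>, and the \<open>p\<close>-th power has Lipschitz constant \<open>p\<close> on \<open>(0, 1]\<close>. This
gives the bound \<open>p * z\<^sup>2 = v\<^sup>2 / p\<close>.\<close>

lemma exp_sub_powr_bound:
  fixes p v :: real
  assumes "1 \<le> p" and "v \<le> 0" and pos: "0 < 1 + v / p"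
  shows "\<bar>exp v - (1 + v / p) powr p\<bar> \<le> v\<^sup>2 / p"
proof -
  define z where "z = v / p"
  have z: "z \<le> 0" "0 < 1 + z" "p * z = v" using assms by (auto simp: z_def divide_le_0_iff)
  have "exp z \<le> 1 + z + z\<^sup>2"
  proof -
    have "1 - z \<le> exp (- z)" using exp_ge_add_one_self[of "- z"] by simp
    then have "exp z \<le> 1 / (1 - z)" using z by (simp add: exp_minus field_simps)
    also have "\<dots> \<le> 1 + z + z\<^sup>2"
    proof -
      have "(1 + z + z\<^sup>2) * (1 - z) = 1 - z ^ 3" by algebra
      moreover have "z ^ 3 \<le> 0" using z by (simp add: power_le_zero_eq)
      ultimately show ?thesis using z by (simp add: divide_le_eq)
    qed
    finally show ?thesis .
  qed
  then have "\<bar>exp z - (1 + z)\<bar> \<le> z\<^sup>2" using exp_ge_add_one_self[of z] by simp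
  then have "p * \<bar>exp z - (1 + z)\<bar> \<le> p * z\<^sup>2" using assms by (intro mult_left_mono) auto
  moreover have "\<bar>exp z powr p - (1 + z) powr p\<bar> \<le> p * 1 powr (p - 1) * \<bar>exp z - (1 + z)\<bar>"
    using assms z by (intro powr_Lipschitz) auto
  ultimately have "\<bar>exp z powr p - (1 + z) powr p\<bar> \<le> p * z\<^sup>2"
    by simp
  moreover have "exp z powr p = exp v" using z(3) by (simp add: powr_def mult.commute)
  moreover have "p * z\<^sup>2 = v\<^sup>2 / p" using assms by (simp add: z_def power_divide power2_eq_square)
  ultimately show ?thesis by (simp add: z_def)
qed

definition liouville_profile :: "real \<Rightarrow> real" where
  "liouville_profile t = ln (4 * exp (sqrt 2 * t) / (1 + exp (sqrt 2 * t))\<^sup>2)"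

definition liouville_slope :: "real \<Rightarrow> real" where
  "liouville_slope t = sqrt 2 - 2 * sqrt 2 * exp (sqrt 2 * t) / (1 + exp (sqrt 2 * t))"

lemma one_plus_exp_pos: "0 < 1 + exp (x::real)"
  by (simp add: add_pos_pos)

lemma liouville_profile_eq:
  "liouville_profile t = ln 4 + sqrt 2 * t - 2 * ln (1 + exp (sqrt 2 * t))"
  using one_plus_exp_pos[of "sqrt 2 * t"]
  by (simp add: liouville_profile_def ln_div ln_mult ln_realpow)

lemma DERIV_liouville_profile:
  "(liouville_profile has_real_derivative liouville_slope t) (at t)"
proof -
  have "((\<lambda>t. ln 4 + sqrt 2 * t - 2 * ln (1 + exp (sqrt 2 * t))) has_real_derivative
      liouville_slope t) (at t)"
    using one_plus_exp_pos[of "sqrt 2 * t"]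
    by (auto intro!: derivative_eq_intros simp: liouville_slope_def field_simps)
  then show ?thesis by (simp add: liouville_profile_eq[abs_def])
qed

text \<open>This is the Liouville equation \<open>U'' = - exp U\<close>, since \<open>exp U = 4 * E / (1 + E)\<^sup>2\<close> with
\<open>E = exp (sqrt 2 * t)\<close>.\<close>

lemma DERIV_liouville_slope:
  "(liouville_slope has_real_derivative - exp (liouville_profile t)) (at t)"
proof -
  let ?E = "exp (sqrt 2 * t)"
  have pos: "0 < 1 + ?E" by (rule one_plus_exp_pos)
  have "((\<lambda>t. sqrt 2 - 2 * sqrt 2 * exp (sqrt 2 * t) / (1 + exp (sqrt 2 * t)))
      has_real_derivative - (4 * ?E / (1 + ?E)\<^sup>2)) (at t)"
  proof -
    have "((\<lambda>t. sqrt 2 - 2 * sqrt 2 * exp (sqrt 2 * t) / (1 + exp (sqrt 2 * t)))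
      has_real_derivative 0 - (2 * sqrt 2 * (?E * sqrt 2) * (1 + ?E)
        - 2 * sqrt 2 * ?E * (?E * sqrt 2)) / ((1 + ?E) * (1 + ?E))) (at t)"
      using pos by (auto intro!: derivative_eq_intros)
    moreover have "2 * sqrt 2 * (?E * sqrt 2) * (1 + ?E) - 2 * sqrt 2 * ?E * (?E * sqrt 2) = 4 * ?E"
      by (simp add: algebra_simps)
    ultimately show ?thesis by (simp add: power2_eq_square)
  qed
  moreover have "exp (liouville_profile t) = 4 * ?E / (1 + ?E)\<^sup>2"
    using pos by (simp add: liouville_profile_def)
  ultimately show ?thesis by (simp add: liouville_slope_def[abs_def])
qed

text \<open>Non-positivity confines the comparison with \<open>v\<close> to the region where \<open>exp\<close> has Lipschitz constant 1.\<close>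

lemma liouville_profile_nonpos: "liouville_profile t \<le> 0"
proof -
  let ?E = "exp (sqrt 2 * t)"
  have "0 \<le> (1 - ?E)\<^sup>2" by simp
  then have "4 * ?E \<le> (1 + ?E)\<^sup>2" by (simp add: power2_eq_square algebra_simps)
  then show ?thesis using one_plus_exp_pos[of "sqrt 2 * t"]
    by (simp add: liouville_profile_def ln_le_zero_iff divide_le_eq)
qed

lemma liouville_initial: "liouville_profile 0 = 0" "liouville_slope 0 = 0"
  by (simp_all add: liouville_profile_def liouville_slope_def)

text \<open>The equation satisfied by a rescaled solution, with \<open>v1\<close> the derivative of \<open>v\<close>. In terms of the original
solution, the last two conditions say that it is positive and that its maximum is at the centre.\<close>

definition emden_solution :: "real \<Rightarrow> real \<Rightarrow> (real \<Rightarrow> real) \<Rightarrow> (real \<Rightarrow> real) \<Rightarrow> bool" where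
  "emden_solution p T v v1 \<longleftrightarrow> v 0 = 0 \<and> v1 0 = 0 \<and>
    (\<forall>t. \<bar>t\<bar> < T \<longrightarrow> (v has_real_derivative v1 t) (at t) \<and>
      (v1 has_real_derivative - ((1 + v t / p) powr p)) (at t) \<and> 0 < 1 + v t / p \<and> v t \<le> 0)"

lemma emden_solutionD:
  assumes "emden_solution p T v v1" and "\<bar>t\<bar> < T"
  shows "(v has_real_derivative v1 t) (at t)"
    and "(v1 has_real_derivative - ((1 + v t / p) powr p)) (at t)"
    and "0 < 1 + v t / p" and "v t \<le> 0"
  using assms by (auto simp: emden_solution_def)

lemma emden_solution_initial:
  "emden_solution p T v v1 \<Longrightarrow> v 0 = 0" "emden_solution p T v v1 \<Longrightarrow> v1 0 = 0"
  by (auto simp: emden_solution_def)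

text \<open>Multiplying the equation by \<open>v'\<close> and integrating gives the conserved energy
\<open>v'\<^sup>2 + 2 * p / (p + 1) * (1 + v / p) powr (p + 1)\<close>, whose value at 0 is \<open>2 * p / (p + 1) < 2\<close>.
The bound does not depend on \<open>p\<close>, which makes all later estimates uniform.\<close>

lemma emden_solution_slope_bound:
  fixes v v1 :: "real \<Rightarrow> real"
  assumes "1 < p"
    and sol: "emden_solution p T v v1" and t: "\<bar>t\<bar> < T"
  shows "\<bar>v1 t\<bar> \<le> sqrt 2"
proof -
  note v = emden_solutionD(1)[OF sol] and v1 = emden_solutionD(2)[OF sol]
    and pos = emden_solutionD(3)[OF sol]
    and init = emden_solution_initial[OF sol]
  let ?E = "\<lambda>s. (v1 s)\<^sup>2 + 2 * p / (p + 1) * (1 + v s / p) powr (p + 1)"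
  have "?E t = ?E 0"
  proof (rule DERIV_isconst3[where f = ?E and a = "- T" and b = T])
    fix s assume "s \<in> {- T<..<T}"
    then have s: "\<bar>s\<bar> < T" by auto
    show "(?E has_real_derivative 0) (at s)"
      using pos[OF s] \<open>1 < p\<close>
      by (auto intro!: derivative_eq_intros v s v1 simp: power2_eq_square)
  qed (use t in auto)
  moreover have "0 \<le> 2 * p / (p + 1) * (1 + v t / p) powr (p + 1)" using \<open>1 < p\<close> by simp
  ultimately have "(v1 t)\<^sup>2 \<le> 2 * p / (p + 1)" using init by simp
  also have "\<dots> \<le> 2" using \<open>1 < p\<close> by (simp add: divide_simps)
  finally show ?thesis by (metis real_sqrt_abs real_sqrt_le_iff)
qed

lemma emden_solution_linear_bound:
  fixes v v1 :: "real \<Rightarrow> real"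
  assumes "1 < p"
    and sol: "emden_solution p T v v1" and t: "\<bar>t\<bar> < T"
  shows "\<bar>v t\<bar> \<le> sqrt 2 * \<bar>t\<bar>"
proof -
  note v = emden_solutionD(1)[OF sol] and init = emden_solution_initial[OF sol]
  have "norm (v t - v 0) \<le> sqrt 2 * norm (t - 0)"
  proof (rule field_differentiable_bound[where S = "{- T<..<T}"])
    fix s assume "s \<in> {- T<..<T}"
    then have s: "\<bar>s\<bar> < T" by auto
    show "(v has_field_derivative v1 s) (at s within {- T<..<T})"
      using v[OF s] by (rule has_field_derivative_at_within)
    show "norm (v1 s) \<le> sqrt 2"
      using emden_solution_slope_bound[OF \<open>1 < p\<close> sol s] by simp
  qed (use t in auto)
  then show ?thesis using init by simp
qed

text \<open>A function of slope at most \<open>sqrt 2\<close> needs time at least \<open>p / sqrt 2\<close> to fall from 0 to \<open>- p\<close>. The value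
\<open>- p\<close> is the rescaled Dirichlet condition. The equation holds only for \<open>|t| < T\<close>, so the bound is
carried to the end point by continuity.\<close>

lemma emden_lifespan_ge:
  fixes v v1 :: "real \<Rightarrow> real"
  assumes "1 < p" "0 < T"
    and sol: "emden_solution p T v v1" and "v T = - p" and cont: "continuous_on {0..T} v"
  shows "p \<le> sqrt 2 * T"
proof -
  have "0 \<le> sqrt 2 * T + v T"
  proof (rule continuous_ge_on_closure[where S = "{0<..<T}" and f = "\<lambda>t. sqrt 2 * t + v t"])
    show "continuous_on (closure {0<..<T}) (\<lambda>t. sqrt 2 * t + v t)"
      using \<open>0 < T\<close> by (auto intro!: continuous_intros cont)
    fix t assume "t \<in> {0<..<T}"
    then show "0 \<le> sqrt 2 * t + v t"
      using emden_solution_linear_bound[OF \<open>1 < p\<close> sol, of t] by auto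
  qed (use \<open>0 < T\<close> in auto)
  then show ?thesis using \<open>v T = - p\<close> by simp
qed

text \<open>On \<open>[-|t|, |t|]\<close> the difference \<open>d = v - U\<close> satisfies \<open>|d''| \<le> |d| + 2 * t\<^sup>2 / p\<close>: the first term comes
from the Lipschitz constant of \<open>exp\<close> on the non-positive half line, the second from replacing
\<open>(1 + v / p) powr p\<close> by \<open>exp v\<close> where \<open>|v| \<le> sqrt 2 * |t|\<close>.\<close>

lemma emden_solution_near_liouville:
  fixes v v1 :: "real \<Rightarrow> real"
  assumes "1 < p"
    and sol: "emden_solution p T v v1" and t: "\<bar>t\<bar> < T"
  shows "(v t - liouville_profile t)\<^sup>2 + (v1 t - liouville_slope t)\<^sup>2
    \<le> (2 * t\<^sup>2 / p)\<^sup>2 * exp (3 * \<bar>t\<bar>)"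
proof -
  note v = emden_solutionD(1)[OF sol] and v1 = emden_solutionD(2)[OF sol]
    and pos = emden_solutionD(3)[OF sol] and nonpos = emden_solutionD(4)[OF sol]
    and init = emden_solution_initial[OF sol]
  let ?U = liouville_profile and ?U1 = liouville_slope
  have "(v t - ?U t)\<^sup>2 + (v1 t - ?U1 t)\<^sup>2 \<le> (2 * t\<^sup>2 / p)\<^sup>2 * exp ((2 + 1) * \<bar>t\<bar>)"
  proof (rule gronwall_second_order[where d'' = "\<lambda>s. - ((1 + v s / p) powr p) + exp (?U s)"])
    fix s assume "\<bar>s\<bar> \<le> \<bar>t\<bar>"
    then have s: "\<bar>s\<bar> < T" using t by simp
    show "((\<lambda>s. v s - ?U s) has_real_derivative v1 s - ?U1 s) (at s)"
      by (intro DERIV_diff v s DERIV_liouville_profile)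
    show "((\<lambda>s. v1 s - ?U1 s) has_real_derivative - ((1 + v s / p) powr p) + exp (?U s)) (at s)"
      using DERIV_diff[OF v1[OF s] DERIV_liouville_slope] by simp
    have "\<bar>exp (v s) - (1 + v s / p) powr p\<bar> \<le> (v s)\<^sup>2 / p"
      using \<open>1 < p\<close> by (intro exp_sub_powr_bound nonpos pos s) auto
    also have "\<dots> \<le> 2 * t\<^sup>2 / p"
    proof -
      have "\<bar>v s\<bar> \<le> sqrt 2 * \<bar>t\<bar>"
        using emden_solution_linear_bound[OF \<open>1 < p\<close> sol s] \<open>\<bar>s\<bar> \<le> \<bar>t\<bar>\<close>
        by (smt (verit) mult_left_mono real_sqrt_ge_zero)
      then have "\<bar>v s\<bar>\<^sup>2 \<le> (sqrt 2 * \<bar>t\<bar>)\<^sup>2" by (intro power_mono) auto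
      then show ?thesis using \<open>1 < p\<close> by (simp add: power_mult_distrib divide_right_mono)
    qed
    finally have 1: "\<bar>exp (v s) - (1 + v s / p) powr p\<bar> \<le> 2 * t\<^sup>2 / p" .
    have "norm (exp (?U s) - exp (v s)) \<le> 1 * norm (?U s - v s)"
      by (rule field_differentiable_bound[where S = "{..0}" and f' = exp])
        (use nonpos[OF s] liouville_profile_nonpos in
          \<open>auto intro: has_field_derivative_at_within DERIV_exp\<close>)
    then show "\<bar>- ((1 + v s / p) powr p) + exp (?U s)\<bar> \<le> 1 * \<bar>v s - ?U s\<bar> + 2 * t\<^sup>2 / p"
      using 1 by simp
  qed (use init liouville_initial in auto)
  then show ?thesis by simp
qed

section \<open>Symmetry of the one-dimensional Dirichlet problem\<close>

lemma DERIV_translate: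
  assumes "(f has_real_derivative D) (at (m + s))"
  shows "((\<lambda>s. f (m + s)) has_real_derivative D) (at s)"
proof -
  have "((\<lambda>s. m + s) has_real_derivative 0 + 1) (at s)"
    by (intro DERIV_add DERIV_const DERIV_ident)
  from DERIV_chain2[OF assms this] show ?thesis by simp
qed

lemma DERIV_reflect:
  assumes "(f has_real_derivative D) (at (m - s))"
  shows "((\<lambda>s. f (m - s)) has_real_derivative - D) (at s)"
proof -
  have "((\<lambda>s. m - s) has_real_derivative 0 - 1) (at s)"
    by (intro DERIV_diff DERIV_const DERIV_ident)
  from DERIV_chain2[OF assms this] show ?thesis by simp
qed

text \<open>Reflecting \<open>w\<close> about its maximum point \<open>m\<close>, where \<open>w' m = 0\<close>, gives another solution with the same
initial data at \<open>m\<close>. The nonlinearity is Lipschitz on \<open>(0, w m]\<close>, so the two agree as long as both arguments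
lie in the interval. If \<open>m\<close> were not the centre, the nearer end point, where \<open>w\<close> vanishes, would be
reflected to an interior point, where \<open>w\<close> is positive.\<close>

lemma emden_dirichlet_max_at_centre:
  fixes w w1 :: "real \<Rightarrow> real"
  assumes "1 < p" "0 < L"
    and cont: "continuous_on {- L..L} w"
    and w: "\<And>s. \<bar>s\<bar> < L \<Longrightarrow> (w has_real_derivative w1 s) (at s)"
    and w1: "\<And>s. \<bar>s\<bar> < L \<Longrightarrow> (w1 has_real_derivative - (w s powr p)) (at s)"
    and pos: "\<And>s. \<bar>s\<bar> < L \<Longrightarrow> 0 < w s"
    and bdry: "w (- L) = 0" "w L = 0"
  shows "w1 0 = 0" and "\<And>s. \<bar>s\<bar> \<le> L \<Longrightarrow> w s \<le> w 0"
proof -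
  have "\<exists>m\<in>{- L..L}. \<forall>s\<in>{- L..L}. w s \<le> w m"
    using \<open>0 < L\<close> by (intro continuous_attains_sup cont) auto
  then obtain m where m: "m \<in> {- L..L}" and max: "\<And>s. s \<in> {- L..L} \<Longrightarrow> w s \<le> w m"
    by blast
  have "0 < w m" using pos[of 0] max[of 0] \<open>0 < L\<close> by force
  then have "m \<noteq> L" "m \<noteq> - L" using bdry by auto
  \<comment> \<open>The distance from \<open>m\<close> to the nearer end point.\<close>
  define \<rho> where "\<rho> = L - \<bar>m\<bar>"
  have "0 < \<rho>" using m \<open>m \<noteq> L\<close> \<open>m \<noteq> - L\<close> by (auto simp: \<rho>_def)
  have inside: "\<bar>m + s\<bar> < L" "\<bar>m - s\<bar> < L" if "\<bar>s\<bar> < \<rho>" for s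
    using that by (auto simp: \<rho>_def)
  have crit: "w1 m = 0"
  proof (rule DERIV_local_max[of w _ m \<rho>])
    show "(w has_real_derivative w1 m) (at m)" using inside[of 0] \<open>0 < \<rho>\<close> by (intro w) simp
    show "\<forall>y. \<bar>m - y\<bar> < \<rho> \<longrightarrow> w y \<le> w m" using m by (auto simp: \<rho>_def intro!: max)
  qed (fact \<open>0 < \<rho>\<close>)
  have even: "w (m + t) - w (m - t) = 0" if t: "t \<in> {- \<rho><..<\<rho>}" for t
  proof -
    let ?K = "p * w m powr (p - 1)"
    have "(w (m + t) - w (m - t))\<^sup>2 + (w1 (m + t) + w1 (m - t))\<^sup>2
        \<le> 0\<^sup>2 * exp ((2 + ?K) * \<bar>t\<bar>)"
    proof (rule gronwall_second_order[where d'' = "\<lambda>s. - (w (m + s) powr p) + w (m - s) powr p"])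
      fix s assume "\<bar>s\<bar> \<le> \<bar>t\<bar>"
      then have s: "\<bar>m + s\<bar> < L" "\<bar>m - s\<bar> < L" using t by (auto intro!: inside)
      show "((\<lambda>s. w (m + s) - w (m - s)) has_real_derivative w1 (m + s) + w1 (m - s)) (at s)"
        using DERIV_diff[OF DERIV_translate[OF w[OF s(1)]] DERIV_reflect[OF w[OF s(2)]]] by simp
      show "((\<lambda>s. w1 (m + s) + w1 (m - s)) has_real_derivative
          - (w (m + s) powr p) + w (m - s) powr p) (at s)"
        using DERIV_add[OF DERIV_translate[OF w1[OF s(1)]] DERIV_reflect[OF w1[OF s(2)]]] by simp
      have "\<bar>w (m - s) powr p - w (m + s) powr p\<bar> \<le> ?K * \<bar>w (m - s) - w (m + s)\<bar>"
      proof (rule powr_Lipschitz)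
        show "w (m - s) \<in> {0<..w m}" "w (m + s) \<in> {0<..w m}"
          using s pos[OF s(1)] pos[OF s(2)] max[of "m + s"] max[of "m - s"]
          by (simp_all add: abs_less_iff)
      qed (use \<open>1 < p\<close> in simp)
      then show "\<bar>- (w (m + s) powr p) + w (m - s) powr p\<bar>
          \<le> ?K * \<bar>w (m + s) - w (m - s)\<bar> + 0"
        by (simp add: abs_minus_commute)
    qed (use \<open>1 < p\<close> crit in auto)
    then have "(w (m + t) - w (m - t))\<^sup>2 + (w1 (m + t) + w1 (m - t))\<^sup>2 \<le> 0" by simp
    then show ?thesis by (simp add: sum_power2_le_zero_iff)
  qed
  have "w (m + \<rho>) - w (m - \<rho>) = 0"
  proof (rule continuous_constant_on_closure[where S = "{- \<rho><..<\<rho>}" and f = "\<lambda>t. w (m + t) - w (m - t)"])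
    have "continuous_on {- \<rho>..\<rho>} (\<lambda>t. w (m + t) - w (m - t))"
      by (intro continuous_intros continuous_on_compose2[OF cont]) (auto simp: \<rho>_def)
    then show "continuous_on (closure {- \<rho><..<\<rho>}) (\<lambda>t. w (m + t) - w (m - t))"
      using \<open>0 < \<rho>\<close> by simp
  qed (use even \<open>0 < \<rho>\<close> in auto)
  have "m = 0"
  proof (rule ccontr)
    assume "m \<noteq> 0"
    then consider "0 < m" "m < L" | "m < 0" "- L < m"
      using m \<open>m \<noteq> L\<close> \<open>m \<noteq> - L\<close> by fastforce
    then show False
    proof cases
      case 1
      then have "m + \<rho> = L" "\<bar>m - \<rho>\<bar> < L" by (auto simp: \<rho>_def)
      then show False using \<open>w (m + \<rho>) - w (m - \<rho>) = 0\<close> bdry pos[of "m - \<rho>"] by simp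
    next
      case 2
      then have "m - \<rho> = - L" "\<bar>m + \<rho>\<bar> < L" by (auto simp: \<rho>_def)
      then show False using \<open>w (m + \<rho>) - w (m - \<rho>) = 0\<close> bdry pos[of "m + \<rho>"] by simp
    qed
  qed
  then show "w1 0 = 0" and "\<And>s. \<bar>s\<bar> \<le> L \<Longrightarrow> w s \<le> w 0"
    using crit max by (auto simp: abs_le_iff)
qed

section \<open>Radial functions on the annulus\<close>

text \<open>A non-empty open set is not negligible, so a continuous function cannot exceed its essential supremum
anywhere on an open set.\<close>

lemma Linf_norm_eq_max:
  fixes f :: "'a::euclidean_space \<Rightarrow> real"
  assumes "open S" and cont: "continuous_on S f" and "x \<in> S"
    and max: "\<And>y. y \<in> S \<Longrightarrow> \<bar>f y\<bar> \<le> \<bar>f x\<bar>"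
  shows "Linf_norm S f = \<bar>f x\<bar>"
proof -
  let ?M = "lebesgue_on S" and ?g = "\<lambda>y. ereal \<bar>f y\<bar>"
  have S: "S \<in> sets lebesgue" using \<open>open S\<close> by simp
  have contg: "continuous_on S ?g" by (intro continuous_intros cont)
  have "f \<in> borel_measurable ?M" by (rule continuous_imp_measurable_on_sets_lebesgue[OF cont S])
  then have meas: "?g \<in> borel_measurable ?M" by measurable
  have "esssup ?M ?g \<le> ?g x"
    by (rule esssup_I[OF meas]) (auto simp: space_restrict_space intro!: AE_I2 max)
  moreover have "?g x \<le> esssup ?M ?g"
  proof (rule ccontr)
    assume "\<not> ?g x \<le> esssup ?M ?g"
    define V where "V = S \<inter> ?g -` {esssup ?M ?g <..}"
    have "open V" unfolding V_def
      by (rule continuous_open_preimage[OF contg \<open>open S\<close>]) simp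
    moreover have "x \<in> V" using \<open>x \<in> S\<close> \<open>\<not> _\<close> by (simp add: V_def)
    ultimately have "\<not> negligible V" using open_not_negligible by blast
    moreover have "emeasure lebesgue V = 0"
    proof -
      have "emeasure ?M V = 0"
        using esssup_zero_measure[of ?M ?g] by (simp add: V_def space_restrict_space vimage_def Int_def conj_commute)
      then show ?thesis using S by (simp add: emeasure_restrict_space V_def)
    qed
    ultimately show False
      using \<open>open V\<close> by (simp add: negligible_iff_null_sets null_sets_def)
  qed
  ultimately have "esssup ?M ?g = ?g x" by (rule antisym)
  then show ?thesis by (simp add: Linf_norm_def)
qed

lemma open_annulus: "open (annulus a b)"
  unfolding annulus_def by (intro open_Collect_conj open_Collect_less continuous_intros)

lemma norm_axis_coordinates:
  "norm (r *\<^sub>R axis 1 1 + t *\<^sub>R axis 2 1 :: real^2) = sqrt (r\<^sup>2 + t\<^sup>2)"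
  by (simp add: norm_vec_def L2_set_def sum_2 axis_def)

lemma norm_first_axis: "norm (r *\<^sub>R axis 1 1 :: real^2) = \<bar>r\<bar>"
  using norm_axis_coordinates[of r 0] by simp

lemma first_axis_in_annulus: "r \<in> {a<..<b} \<Longrightarrow> 0 \<le> a \<Longrightarrow> r *\<^sub>R axis 1 1 \<in> annulus a b"
  by (simp add: annulus_def norm_first_axis)

lemma first_axis_in_closure_annulus:
  assumes "0 \<le> a" "a < b" "r \<in> {a..b}"
  shows "r *\<^sub>R axis 1 1 \<in> closure (annulus a b)"
proof -
  have "(\<lambda>r. r *\<^sub>R axis 1 1) ` closure {a<..<b} \<subseteq> closure ((\<lambda>r. r *\<^sub>R axis 1 1 :: real^2) ` {a<..<b})"
    by (intro image_closure_subset continuous_intros closure_subset closed_closure)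
  also have "\<dots> \<subseteq> closure (annulus a b)"
    using first_axis_in_annulus \<open>0 \<le> a\<close> by (intro closure_mono) blast
  finally show ?thesis using assms by auto
qed

lemma first_axis_in_frontier_annulus:
  assumes "0 \<le> a" "a < b" "r = a \<or> r = b"
  shows "r *\<^sub>R axis 1 1 \<in> frontier (annulus a b)"
proof -
  have "r *\<^sub>R axis 1 1 \<notin> annulus a b" using assms by (auto simp: annulus_def norm_first_axis)
  then show ?thesis
    using assms first_axis_in_closure_annulus[of a b r]
    by (auto simp: frontier_def interior_open[OF open_annulus])
qed

lemma C1_on_DERIV_partial:
  "C1_on S f \<Longrightarrow> x \<in> S \<Longrightarrow>
    ((\<lambda>t. f (x + t *\<^sub>R axis i 1)) has_real_derivative partial_deriv i f x) (at 0)"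
  unfolding C1_on_def partial_deriv_def by (simp add: DERIV_deriv_iff_real_differentiable)

lemma DERIV_radial_profile:
  assumes "C1_on S f" and "r *\<^sub>R axis 1 1 \<in> S"
  shows "(radial_profile f has_real_derivative radial_profile (partial_deriv 1 f) r) (at r)"
proof -
  have "((\<lambda>t. radial_profile f (t + r)) has_real_derivative radial_profile (partial_deriv 1 f) r) (at 0)"
    using C1_on_DERIV_partial[OF assms, of 1]
    by (simp add: radial_profile_def algebra_simps)
  then show ?thesis using DERIV_shift[of "radial_profile f" _ 0 r] by simp
qed

text \<open>The difference quotient at 0 is \<open>q t\<close> itself, so continuity replaces the product rule. For a radial
function \<open>\<partial>\<^sub>2 u\<close> has this form near the first axis, with \<open>q\<close> built from the first radial derivative.\<close>

lemma DERIV_mult_self_at_0: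
  fixes q :: "real \<Rightarrow> real"
  assumes "isCont q 0"
  shows "((\<lambda>t. q t * t) has_real_derivative q 0) (at 0)"
  unfolding CARAT_DERIV using assms by (intro exI[of _ q]) auto

lemma radially_symmetric_eq_profile:
  assumes "radially_symmetric_on (annulus a b) u" "0 \<le> a" "x \<in> annulus a b"
  shows "u x = radial_profile u (norm x)"
proof -
  have "norm x *\<^sub>R axis 1 1 \<in> annulus a b"
    using assms by (intro first_axis_in_annulus) (auto simp: annulus_def)
  then show ?thesis using assms unfolding radially_symmetric_on_def radial_profile_def
    by (metis abs_norm_cancel norm_first_axis)
qed

lemma DERIV_sqrt_sum_squares:
  "0 < r \<Longrightarrow> ((\<lambda>s. sqrt (r\<^sup>2 + s\<^sup>2)) has_real_derivative t / sqrt (r\<^sup>2 + t\<^sup>2)) (at t)"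
  by (auto intro!: derivative_eq_intros simp: add_pos_nonneg divide_simps not_sum_power2_lt_zero)

text \<open>Along the first axis the first coordinate direction is the radial one, which contributes \<open>\<phi>''\<close>. In the second
direction, \<open>\<partial>\<^sub>2 u\<close> at \<open>(r, t)\<close> equals \<open>q t * t\<close> with \<open>q t = \<phi>' \<rho> / \<rho>\<close> and
\<open>\<rho> = sqrt (r\<^sup>2 + t\<^sup>2)\<close>. Its derivative at \<open>t = 0\<close> is \<open>q 0 = \<phi>' r / r\<close>.\<close>

lemma laplacian_radial:
  assumes "0 \<le> a" and C2: "C2_on (annulus a b) u"
    and sym: "radially_symmetric_on (annulus a b) u" and r: "r \<in> {a<..<b}"
  shows "laplacian u (r *\<^sub>R axis 1 1) =
    radial_profile (partial_deriv 1 (partial_deriv 1 u)) r + radial_profile (partial_deriv 1 u) r / r"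
proof -
  let ?A = "annulus a b" and ?\<phi> = "radial_profile u" and ?\<phi>' = "radial_profile (partial_deriv 1 u)"
  let ?x = "\<lambda>t. r *\<^sub>R axis 1 1 + t *\<^sub>R axis 2 1 :: real^2"
  have "0 < r" using r \<open>0 \<le> a\<close> by simp
  have C1: "C1_on ?A u" "C1_on ?A (partial_deriv 1 u)" using C2 by (auto simp: C2_on_def)
  have D\<phi>: "(?\<phi> has_real_derivative ?\<phi>' s) (at s)" if "s \<in> {a<..<b}" for s
    by (rule DERIV_radial_profile[OF C1(1) first_axis_in_annulus[OF that \<open>0 \<le> a\<close>]])
  have D\<phi>': "isCont ?\<phi>' s" if "s \<in> {a<..<b}" for s
    by (rule DERIV_isCont[OF DERIV_radial_profile[OF C1(2) first_axis_in_annulus[OF that \<open>0 \<le> a\<close>]]])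
  define T where "T = ?x -` ?A"
  have "open T" unfolding T_def
    by (intro open_vimage open_annulus continuous_intros)
  have "0 \<in> T" using first_axis_in_annulus[OF r \<open>0 \<le> a\<close>] by (simp add: T_def)
  have T: "sqrt (r\<^sup>2 + t\<^sup>2) \<in> {a<..<b}" if "t \<in> T" for t
    using that by (simp add: T_def annulus_def norm_axis_coordinates)
  have u_on_T: "u (?x t) = ?\<phi> (sqrt (r\<^sup>2 + t\<^sup>2))" if "t \<in> T" for t
    using radially_symmetric_eq_profile[OF sym \<open>0 \<le> a\<close>, of "?x t"] that
    by (simp add: T_def norm_axis_coordinates)
  define q where "q t = ?\<phi>' (sqrt (r\<^sup>2 + t\<^sup>2)) / sqrt (r\<^sup>2 + t\<^sup>2)" for t
  have partial2: "partial_deriv 2 u (?x t) = q t * t" if t: "t \<in> T" for t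
  proof -
    have "((\<lambda>s. ?\<phi> (sqrt (r\<^sup>2 + s\<^sup>2))) has_real_derivative
        ?\<phi>' (sqrt (r\<^sup>2 + t\<^sup>2)) * (t / sqrt (r\<^sup>2 + t\<^sup>2))) (at t)"
      by (rule DERIV_chain2[OF D\<phi>[OF T[OF t]] DERIV_sqrt_sum_squares[OF \<open>0 < r\<close>]])
    then have "((\<lambda>s. u (?x s)) has_real_derivative q t * t) (at t)"
      by (rule has_field_derivative_transform_within_open[OF _ \<open>open T\<close> t, THEN DERIV_cong])
        (simp_all add: u_on_T q_def)
    then have "((\<lambda>s. u (?x (s + t))) has_real_derivative q t * t) (at 0)"
      using DERIV_shift[of "\<lambda>s. u (?x s)" _ 0 t] by simp
    then show ?thesis
      unfolding partial_deriv_def by (intro DERIV_imp_deriv) (simp add: algebra_simps)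
  qed
  have "isCont q 0"
  proof -
    have root: "isCont (\<lambda>t. sqrt (r\<^sup>2 + t\<^sup>2)) 0" by (intro continuous_intros)
    have "isCont ?\<phi>' (sqrt (r\<^sup>2 + 0\<^sup>2))" using D\<phi>'[OF r] \<open>0 < r\<close> by simp
    from isCont_divide[OF isCont_o2[OF root this] root]
    have "isCont (\<lambda>t. ?\<phi>' (sqrt (r\<^sup>2 + t\<^sup>2)) / sqrt (r\<^sup>2 + t\<^sup>2)) 0"
      using \<open>0 < r\<close> by simp
    then show ?thesis by (simp only: q_def[abs_def])
  qed
  then have "((\<lambda>t. q t * t) has_real_derivative q 0) (at 0)" by (rule DERIV_mult_self_at_0)
  then have "((\<lambda>t. partial_deriv 2 u (?x t)) has_real_derivative q 0) (at 0)"
    by (rule has_field_derivative_transform_within_open[OF _ \<open>open T\<close> \<open>0 \<in> T\<close>]) (simp add: partial2)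
  then have "partial_deriv 2 (partial_deriv 2 u) (r *\<^sub>R axis 1 1) = q 0"
    by (simp add: partial_deriv_def[of 2 "partial_deriv 2 u"] DERIV_imp_deriv)
  also have "q 0 = ?\<phi>' r / r" using \<open>0 < r\<close> by (simp add: q_def)
  finally show ?thesis by (simp add: laplacian_def sum_2 radial_profile_def)
qed

text \<open>In the variable \<open>s = c - ln r\<close> differentiation is \<open>- r * d/dr\<close>, and applying it twice gives
\<open>r\<^sup>2 * (\<phi>'' + \<phi>' / r)\<close>. The factor \<open>r\<^sup>2\<close> cancels the weight on the right-hand side.\<close>

lemma emden_fowler_transform:
  fixes p :: real
  assumes "0 < r" and r: "r = exp (c - s)"
    and \<phi>: "(\<phi> has_real_derivative \<phi>' r) (at r)" and \<phi>': "(\<phi>' has_real_derivative \<phi>'') (at r)"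
    and eq: "- (\<phi>'' + \<phi>' r / r) = \<phi> r powr p / r\<^sup>2"
  shows "((\<lambda>s. \<phi> (exp (c - s))) has_real_derivative - (r * \<phi>' r)) (at s)"
    and "((\<lambda>s. - (exp (c - s) * \<phi>' (exp (c - s)))) has_real_derivative - (\<phi> r powr p)) (at s)"
proof -
  have E: "((\<lambda>s. exp (c - s)) has_real_derivative - r) (at s)"
    by (auto intro!: derivative_eq_intros simp: r)
  have 1: "((\<lambda>s. \<phi> (exp (c - s))) has_real_derivative \<phi>' r * - r) (at s)"
    by (rule DERIV_chain2[OF _ E]) (use \<phi> r in simp)
  then show "((\<lambda>s. \<phi> (exp (c - s))) has_real_derivative - (r * \<phi>' r)) (at s)"
    by (simp add: mult.commute)
  have 2: "((\<lambda>s. \<phi>' (exp (c - s))) has_real_derivative \<phi>'' * - r) (at s)"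
    by (rule DERIV_chain2[OF _ E]) (use \<phi>' r in simp)
  have "- (- r * \<phi>' r + \<phi>'' * - r * r) = - (\<phi> r powr p)"
  proof -
    have "\<phi> r powr p = r\<^sup>2 * (- (\<phi>'' + \<phi>' r / r))" unfolding eq using \<open>0 < r\<close> by simp
    moreover have "r\<^sup>2 * (\<phi>' r / r) = r * \<phi>' r" using \<open>0 < r\<close> by (simp add: power2_eq_square)
    ultimately show ?thesis by (simp add: power2_eq_square algebra_simps)
  qed
  with DERIV_minus[OF DERIV_mult[OF E 2]]
  show "((\<lambda>s. - (exp (c - s) * \<phi>' (exp (c - s)))) has_real_derivative - (\<phi> r powr p)) (at s)"
    by (simp add: r)
qed

text \<open>The shift \<open>ln (a * b) / 2\<close> is the midpoint of \<open>ln a\<close> and \<open>ln b\<close>, so the logarithmic variable ranges over an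
interval symmetric about 0.\<close>

lemma exp_log_midpoint_interval:
  assumes "0 < a" "a < b" 
  shows "\<bar>s\<bar> < (ln b - ln a) / 2 \<longleftrightarrow> exp (ln (a * b) / 2 - s) \<in> {a<..<b::real}"
    and "\<bar>s\<bar> \<le> (ln b - ln a) / 2 \<longleftrightarrow> exp (ln (a * b) / 2 - s) \<in> {a..b}"
proof -
  have "0 < b" using assms by simp
  have *: "x < exp y \<longleftrightarrow> ln x < y" "exp y < x \<longleftrightarrow> y < ln x"
    "x \<le> exp y \<longleftrightarrow> ln x \<le> y" "exp y \<le> x \<longleftrightarrow> y \<le> ln x" if "0 < x" for x y :: real
    using exp_less_cancel_iff[of "ln x" y] exp_less_cancel_iff[of y "ln x"]
      exp_le_cancel_iff[of "ln x" y] exp_le_cancel_iff[of y "ln x"]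
    by (simp_all only: exp_ln[OF that])
  note log_bounds = *[OF \<open>0 < a\<close>] *[OF \<open>0 < b\<close>] ln_mult_pos[OF \<open>0 < a\<close> \<open>0 < b\<close>]
  have midpoint: "\<bar>s\<bar> < (y - x) / 2 \<longleftrightarrow> x < (x + y) / 2 - s \<and> (x + y) / 2 - s < y"
    "\<bar>s\<bar> \<le> (y - x) / 2 \<longleftrightarrow> x \<le> (x + y) / 2 - s \<and> (x + y) / 2 - s \<le> y" for x y
    by (auto simp: abs_less_iff abs_le_iff field_simps)
  show "\<bar>s\<bar> < (ln b - ln a) / 2 \<longleftrightarrow> exp (ln (a * b) / 2 - s) \<in> {a<..<b}"
    unfolding greaterThanLessThan_iff log_bounds by (rule midpoint)
  show "\<bar>s\<bar> \<le> (ln b - ln a) / 2 \<longleftrightarrow> exp (ln (a * b) / 2 - s) \<in> {a..b}"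
    unfolding atLeastAtMost_iff log_bounds by (rule midpoint)
qed

section \<open>Convergence of the rescaled solutions\<close>

text \<open>In the logarithmic variable the solution becomes a Dirichlet solution \<open>w\<close> with maximum \<open>N = w 0\<close>, which is
therefore the \<open>L\<^sup>\<infinity>\<close> norm, and \<open>1 + v t / p = w (e * t) / N\<close>. Two derivatives of \<open>v\<close> bring out the factor
\<open>p * e\<^sup>2 / N\<close>, and the normalisation \<open>p * e\<^sup>2 * N powr (p - 1) = 1\<close> is what makes the coefficient of
\<open>(1 + v / p) powr p\<close> equal to \<open>- 1\<close>.\<close>

lemma rescaled_solution_emden:
  fixes a b p e :: real and u :: "real^2 \<Rightarrow> real"
  defines "v \<equiv> rescaled a b p e u" and "T \<equiv> (ln b - ln a) / (2 * e)"
  assumes "0 < a" "a < b" "1 < p" "0 < e" and sol: "radial_solution a b p u"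
    and scale: "p * e\<^sup>2 * Linf_norm (annulus a b) u powr (p - 1) = 1"
  obtains v1 where "emden_solution p T v v1" and "v T = - p" and "continuous_on {0..T} v"
proof -
  let ?A = "annulus a b"
  define L where "L = (ln b - ln a) / 2"
  define c where "c = ln (a * b) / 2"
  define \<phi> where "\<phi> = radial_profile u"
  define \<phi>' where "\<phi>' = radial_profile (partial_deriv 1 u)"
  define \<phi>'' where "\<phi>'' = radial_profile (partial_deriv 1 (partial_deriv 1 u))"
  define w where "w s = \<phi> (exp (c - s))" for s
  define w1 where "w1 s = - (exp (c - s) * \<phi>' (exp (c - s)))" for s
  have C2: "C2_on ?A u" and cont: "continuous_on (closure ?A) u"
    and sym: "radially_symmetric_on (closure ?A) u"
    and pde: "\<And>x. x \<in> ?A \<Longrightarrow> - laplacian u x = (u x powr p) / (norm x)\<^sup>2"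
    and upos: "\<And>x. x \<in> ?A \<Longrightarrow> 0 < u x" and bdry: "\<And>x. x \<in> frontier ?A \<Longrightarrow> u x = 0"
    using sol unfolding radial_solution_def by blast+
  have symA: "radially_symmetric_on ?A u"
    using sym closure_subset[of ?A] unfolding radially_symmetric_on_def by blast
  have C1: "C1_on ?A u" "C1_on ?A (partial_deriv 1 u)" using C2 by (auto simp: C2_on_def)
  have "0 < L" using \<open>0 < a\<close> \<open>a < b\<close> by (simp add: L_def)
  have T: "T = L / e" by (simp add: T_def L_def)
  have inner: "\<bar>s\<bar> < L \<longleftrightarrow> exp (c - s) \<in> {a<..<b}" and outer: "\<bar>s\<bar> \<le> L \<longleftrightarrow> exp (c - s) \<in> {a..b}" for s
    using exp_log_midpoint_interval[OF \<open>0 < a\<close> \<open>a < b\<close>, of s] by (simp_all only: L_def c_def)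
  have inA: "exp (c - s) *\<^sub>R axis 1 1 \<in> ?A" if "\<bar>s\<bar> < L" for s
    using that \<open>0 < a\<close> unfolding inner by (intro first_axis_in_annulus) auto
  have w: "(w has_real_derivative w1 s) (at s)"
    and w1: "(w1 has_real_derivative - (w s powr p)) (at s)" if s: "\<bar>s\<bar> < L" for s
  proof -
    let ?r = "exp (c - s)"
    have D: "(\<phi> has_real_derivative \<phi>' ?r) (at ?r)" "(\<phi>' has_real_derivative \<phi>'' ?r) (at ?r)"
      unfolding \<phi>_def \<phi>'_def \<phi>''_def
      by (rule DERIV_radial_profile[OF C1(1) inA[OF s]] DERIV_radial_profile[OF C1(2) inA[OF s]])+
    have "?r \<in> {a<..<b}" using s by (simp only: inner)
    then have "- (\<phi>'' ?r + \<phi>' ?r / ?r) = \<phi> ?r powr p / ?r\<^sup>2"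
      using pde[OF inA[OF s]] laplacian_radial[OF _ C2 symA, of ?r] \<open>0 < a\<close>
      by (simp add: \<phi>_def \<phi>'_def \<phi>''_def norm_first_axis radial_profile_def)
    note X = emden_fowler_transform[OF exp_gt_zero refl D this]
    show "(w has_real_derivative w1 s) (at s)" using X(1) by (simp add: w_def[abs_def] w1_def)
    show "(w1 has_real_derivative - (w s powr p)) (at s)"
      using X(2) by (simp add: w_def w1_def[abs_def])
  qed
  have wpos: "0 < w s" if "\<bar>s\<bar> < L" for s
    using upos[OF inA[OF that]] by (simp add: w_def \<phi>_def radial_profile_def)
  have wcont: "continuous_on {- L..L} w"
    unfolding w_def \<phi>_def radial_profile_def
  proof (rule continuous_on_compose2[OF cont])
    show "continuous_on {- L..L} (\<lambda>s. exp (c - s) *\<^sub>R axis 1 1 :: real^2)"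
      by (intro continuous_intros)
    have "exp (c - s) \<in> {a..b}" if "s \<in> {- L..L}" for s
      using outer[of s] that by (auto simp: abs_le_iff)
    then show "(\<lambda>s. exp (c - s) *\<^sub>R axis 1 1) ` {- L..L} \<subseteq> closure ?A"
      using \<open>0 < a\<close> \<open>a < b\<close> by (auto intro!: first_axis_in_closure_annulus)
  qed
  have "exp (c - L) = a" "exp (c + L) = b"
    using \<open>0 < a\<close> \<open>a < b\<close> by (simp_all add: c_def L_def ln_mult field_simps)
  then have wbdry: "w (- L) = 0" "w L = 0"
    using first_axis_in_frontier_annulus[of a b] \<open>0 < a\<close> \<open>a < b\<close>
    by (auto simp: w_def \<phi>_def radial_profile_def intro!: bdry)
  have crit: "w1 0 = 0" and wmax: "\<And>s. \<bar>s\<bar> \<le> L \<Longrightarrow> w s \<le> w 0"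
    using emden_dirichlet_max_at_centre[OF \<open>1 < p\<close> \<open>0 < L\<close> wcont w w1 wpos wbdry] by blast+
  define N where "N = w 0"
  have "0 < N" using wpos[of 0] \<open>0 < L\<close> by (simp add: N_def)
  have "Linf_norm ?A u = \<bar>u (exp (c - 0) *\<^sub>R axis 1 1)\<bar>"
  proof (rule Linf_norm_eq_max[OF open_annulus continuous_on_subset[OF cont closure_subset]])
    show "exp (c - 0) *\<^sub>R axis 1 1 \<in> ?A" using \<open>0 < L\<close> by (intro inA) simp
    fix y assume y: "y \<in> ?A"
    then have "0 < norm y" "norm y \<in> {a<..<b}" using \<open>0 < a\<close> by (auto simp: annulus_def)
    then have r: "exp (c - (c - ln (norm y))) = norm y" by simp
    then have "\<bar>c - ln (norm y)\<bar> < L" using \<open>norm y \<in> _\<close> by (simp only: inner)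
    then have "w (c - ln (norm y)) \<le> w 0" by (intro wmax) simp
    moreover have "u y = w (c - ln (norm y))"
      using radially_symmetric_eq_profile[OF symA _ y] \<open>0 < a\<close> r by (simp add: w_def \<phi>_def)
    ultimately show "\<bar>u y\<bar> \<le> \<bar>u (exp (c - 0) *\<^sub>R axis 1 1)\<bar>"
      using upos[OF y] by (simp add: w_def \<phi>_def radial_profile_def)
  qed
  then have Linf: "Linf_norm ?A u = N"
    using \<open>0 < N\<close> by (simp add: N_def w_def \<phi>_def radial_profile_def)
  have v_eq: "v t = p / N * (w (e * t) - N)" for t
    by (simp add: v_def rescaled_def Linf w_def \<phi>_def c_def)
  have v_frac: "1 + v t / p = w (e * t) / N" for t
    using \<open>0 < N\<close> \<open>1 < p\<close> by (simp add: v_eq field_simps)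
  have in_L: "\<bar>e * t\<bar> < L" if "\<bar>t\<bar> < T" for t
    using that \<open>0 < e\<close> by (simp add: T abs_mult field_simps)
  have scale_by: "((\<lambda>t. e * t) has_real_derivative e) (at t)" for t
    using DERIV_cmult_Id by blast
  define v1 where "v1 t = p / N * (w1 (e * t) * e)" for t
  have "emden_solution p T v v1"
    unfolding emden_solution_def
  proof (intro conjI allI impI)
    show "v 0 = 0" by (simp add: v_eq N_def)
    show "v1 0 = 0" by (simp add: v1_def crit)
    fix t assume "\<bar>t\<bar> < T"
    note t = in_L[OF this]
    have "((\<lambda>t. p / N * (w (e * t) - N)) has_real_derivative p / N * (w1 (e * t) * e - 0)) (at t)"
      by (intro DERIV_cmult DERIV_diff DERIV_const DERIV_chain2[OF w[OF t] scale_by])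
    then show "(v has_real_derivative v1 t) (at t)"
      unfolding v_eq[abs_def] v1_def by (simp only: diff_0_right)
    have "((\<lambda>t. p / N * (w1 (e * t) * e)) has_real_derivative
        p / N * (- (w (e * t) powr p) * e * e)) (at t)"
      by (intro DERIV_cmult DERIV_cmult_right DERIV_chain2[OF w1[OF t] scale_by])
    moreover have "p / N * (- (w (e * t) powr p) * e * e) = - ((1 + v t / p) powr p)"
    proof -
      have "p * e\<^sup>2 * N powr p = N"
        using scale \<open>0 < N\<close> by (simp add: Linf powr_diff field_simps)
      then have "p / N * (e * e) = 1 / N powr p"
        using \<open>0 < N\<close> by (simp add: field_simps power2_eq_square)
      then have "w (e * t) powr p * (p / N * (e * e)) = w (e * t) powr p * (1 / N powr p)"
        by (rule arg_cong)
      then show ?thesis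
        using wpos[OF t] \<open>0 < N\<close> by (simp add: v_frac powr_divide mult_ac)
    qed
    ultimately show "(v1 has_real_derivative - ((1 + v t / p) powr p)) (at t)"
      by (simp only: v1_def[abs_def])
    show "0 < 1 + v t / p" unfolding v_frac using wpos[OF t] \<open>0 < N\<close> by simp
    show "v t \<le> 0" unfolding v_eq
      using wmax[of "e * t"] t \<open>0 < N\<close> \<open>1 < p\<close> by (intro mult_nonneg_nonpos) (auto simp: N_def)
  qed
  moreover have "e * T = L" using \<open>0 < e\<close> by (simp add: T)
  then have "v T = - p" using \<open>0 < N\<close> by (simp add: v_eq wbdry)
  moreover have "continuous_on {0..T} v"
  proof -
    have "continuous_on {0..T} (\<lambda>t. w (e * t))"
    proof (rule continuous_on_compose2[OF wcont])
      show "(\<lambda>t. e * t) ` {0..T} \<subseteq> {- L..L}"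
      proof
        fix s assume "s \<in> (\<lambda>t. e * t) ` {0..T}"
        then obtain t where "s = e * t" "t \<in> {0..T}" by blast
        then have "0 \<le> s" "s \<le> e * T" using \<open>0 < e\<close> by auto
        then show "s \<in> {- L..L}" using \<open>e * T = L\<close> \<open>0 < L\<close> by simp
      qed
    qed (intro continuous_intros)
    then show ?thesis unfolding v_eq by (intro continuous_intros)
  qed
  ultimately show thesis by (rule that)
qed

theorem theorem3:
  fixes a b :: real
    and u :: "real \<Rightarrow> real^2 \<Rightarrow> real"
    and \<epsilon> :: "real \<Rightarrow> real"
  assumes "0 < a" and "a < b"
    and "\<And>p. p > 1 \<Longrightarrow> radial_solution a b p (u p)"
    and "\<And>p. p > 1 \<Longrightarrow> \<epsilon> p > 0"
    and "\<And>p. p > 1 \<Longrightarrow> p * (\<epsilon> p)\<^sup>2 * Linf_norm (annulus a b) (u p) powr (p - 1) = 1"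
  shows "(\<epsilon> \<longlongrightarrow> 0) at_top \<and>
    C1_loc_tendsto
      (\<lambda>p. rescaled_interval a b (\<epsilon> p))
      (\<lambda>p. rescaled a b p (\<epsilon> p) (u p))
      (\<lambda>t. ln (4 * exp (sqrt 2 * t) / (1 + exp (sqrt 2 * t))\<^sup>2))
      at_top"
proof -
  define v where "v p = rescaled a b p (\<epsilon> p) (u p)" for p
  define T where "T p = (ln b - ln a) / (2 * \<epsilon> p)" for p
  have "\<exists>v1. (\<forall>t. \<bar>t\<bar> < T p \<longrightarrow> (v p has_real_derivative v1 t) (at t)
        \<and> isCont v1 t
        \<and> (v p t - liouville_profile t)\<^sup>2 + (v1 t - liouville_slope t)\<^sup>2
            \<le> (2 * t\<^sup>2 / p)\<^sup>2 * exp (3 * \<bar>t\<bar>))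
      \<and> p \<le> sqrt 2 * T p" if p: "1 < p" for p
  proof -
    obtain v1 where sol: "emden_solution p (T p) (v p) v1"
      and endpt: "v p (T p) = - p" "continuous_on {0..T p} (v p)"
      by (rule rescaled_solution_emden[OF assms(1,2) p assms(4)[OF p] assms(3)[OF p]
            assms(5)[OF p], folded v_def T_def])
    have "0 < T p" using assms(1,2) assms(4)[OF p] by (simp add: T_def)
    show ?thesis
      using emden_solutionD(1)[OF sol] DERIV_isCont[OF emden_solutionD(2)[OF sol]]
        emden_solution_near_liouville[OF p sol] emden_lifespan_ge[OF p \<open>0 < T p\<close> sol endpt]
      by blast
  qed
  then obtain v1 where v: "\<And>p t. 1 < p \<Longrightarrow> \<bar>t\<bar> < T p \<Longrightarrow> (v p has_real_derivative v1 p t) (at t)"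
    and v1: "\<And>p t. 1 < p \<Longrightarrow> \<bar>t\<bar> < T p \<Longrightarrow> isCont (v1 p) t"
    and near: "\<And>p t. 1 < p \<Longrightarrow> \<bar>t\<bar> < T p \<Longrightarrow>
      (v p t - liouville_profile t)\<^sup>2 + (v1 p t - liouville_slope t)\<^sup>2
        \<le> (2 * t\<^sup>2 / p)\<^sup>2 * exp (3 * \<bar>t\<bar>)"
    and long: "\<And>p. 1 < p \<Longrightarrow> p \<le> sqrt 2 * T p"
    by metis
  have gt1: "\<forall>\<^sub>F p in at_top. 1 < (p::real)" by (rule eventually_gt_at_top)
  have "(\<epsilon> \<longlongrightarrow> 0) at_top"
  proof (rule tendsto_sandwich[of "\<lambda>_. 0" _ _ "\<lambda>p. sqrt 2 * (ln b - ln a) / 2 * (1 / p)"])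
    show "\<forall>\<^sub>F p in at_top. 0 \<le> \<epsilon> p"
      using gt1 by eventually_elim (simp add: assms(4) less_imp_le)
    show "\<forall>\<^sub>F p in at_top. \<epsilon> p \<le> sqrt 2 * (ln b - ln a) / 2 * (1 / p)"
      using gt1
    proof eventually_elim
      case (elim p)
      then show ?case using long[OF elim] assms(4)[OF elim] by (simp add: T_def field_simps)
    qed
    have "((\<lambda>p::real. 1 / p) \<longlongrightarrow> 0) at_top"
      using tendsto_inverse_0_at_top[OF filterlim_ident] by (simp add: inverse_eq_divide)
    then show "((\<lambda>p. sqrt 2 * (ln b - ln a) / 2 * (1 / p)) \<longlongrightarrow> 0) at_top"
      by (rule tendsto_mult_right_zero)
  qed simp
  moreover have "C1_loc_tendsto (\<lambda>p. {- T p<..<T p}) v liouville_profile at_top"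
    unfolding C1_loc_tendsto_def
  proof (intro conjI allI impI)
    show "\<forall>\<^sub>F p in at_top. v p C1_differentiable_on {- T p<..<T p}"
      using gt1
    proof eventually_elim
      case (elim p)
      have "(v p has_vector_derivative v1 p t) (at t) \<and> isCont (v1 p) t" if "t \<in> {- T p<..<T p}" for t
        using v[OF elim] v1[OF elim] that
        by (auto simp: abs_less_iff simp flip: has_real_derivative_iff_has_vector_derivative)
      then show ?case unfolding C1_differentiable_on_def
        by (intro exI[of _ "v1 p"]) (auto intro: continuous_at_imp_continuous_on)
    qed
    show "liouville_profile C1_differentiable_on UNIV"
      unfolding C1_differentiable_on_def
      using DERIV_liouville_profile DERIV_isCont[OF DERIV_liouville_slope]
      by (auto intro!: exI[of _ liouville_slope] continuous_at_imp_continuous_on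
          simp flip: has_real_derivative_iff_has_vector_derivative)
  next
    fix K :: "real set" assume "compact K"
    then obtain R where "0 < R" and R: "\<And>t. t \<in> K \<Longrightarrow> \<bar>t\<bar> \<le> R"
      using compact_imp_bounded bounded_pos by (metis real_norm_def)
    have large: "\<forall>\<^sub>F p in at_top. 1 < p \<and> (\<forall>t\<in>K. \<bar>t\<bar> < T p)"
      using gt1 eventually_gt_at_top[of "sqrt 2 * R"]
    proof eventually_elim
      case (elim p)
      then have "sqrt 2 * R < sqrt 2 * T p" using long[of p] by linarith
      then show ?case using R elim by force
    qed
    then show "\<forall>\<^sub>F p in at_top. K \<subseteq> {- T p<..<T p}"
      by eventually_elim (auto simp: abs_less_iff)
    \<comment> \<open>The square root of the Gronwall bound at \<open>|t| = R\<close> is \<open>C / p\<close>.\<close>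
    define C where "C = 2 * R\<^sup>2 * exp (3 * R / 2)"
    have close: "\<bar>v p t - liouville_profile t\<bar> \<le> C * (1 / p) \<and> \<bar>v1 p t - liouville_slope t\<bar> \<le> C * (1 / p)"
      if "1 < p" "t \<in> K" "\<bar>t\<bar> < T p" for p t
    proof -
      have "t\<^sup>2 \<le> R\<^sup>2"
        using R[OF \<open>t \<in> K\<close>] \<open>0 < R\<close> by (intro iffD1[OF abs_le_square_iff]) simp
      then have "2 * t\<^sup>2 / p \<le> 2 * R\<^sup>2 / p" using \<open>1 < p\<close> by (simp add: divide_right_mono)
      then have "(2 * t\<^sup>2 / p)\<^sup>2 * exp (3 * \<bar>t\<bar>) \<le> (2 * R\<^sup>2 / p)\<^sup>2 * exp (3 * R)"
        using R[OF \<open>t \<in> K\<close>] \<open>1 < p\<close> by (intro mult_mono power_mono) auto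
      also have "\<dots> = (C * (1 / p))\<^sup>2"
        by (simp add: C_def power_mult_distrib power_divide flip: exp_double)
      finally have "(v p t - liouville_profile t)\<^sup>2 + (v1 p t - liouville_slope t)\<^sup>2 \<le> (C * (1 / p))\<^sup>2"
        using near[OF that(1,3)] by linarith
      then have "(v p t - liouville_profile t)\<^sup>2 \<le> (C * (1 / p))\<^sup>2"
        "(v1 p t - liouville_slope t)\<^sup>2 \<le> (C * (1 / p))\<^sup>2"
        using zero_le_power2[of "v p t - liouville_profile t"]
          zero_le_power2[of "v1 p t - liouville_slope t"] by linarith+
      moreover have "0 \<le> C * (1 / p)" using \<open>1 < p\<close> by (simp add: C_def)
      ultimately show ?thesis by (simp only: power2_le_iff_abs_le)
    qed
    have small: "\<forall>\<^sub>F p in at_top. C * (1 / p) < \<delta>" if "0 < \<delta>" for \<delta> :: real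
    proof -
      have "((\<lambda>p::real. 1 / p) \<longlongrightarrow> 0) at_top"
        using tendsto_inverse_0_at_top[OF filterlim_ident] by (simp add: inverse_eq_divide)
      then have "((\<lambda>p. C * (1 / p)) \<longlongrightarrow> 0) at_top" by (rule tendsto_mult_right_zero)
      then show ?thesis using that by (rule order_tendstoD(2))
    qed
    show "uniform_limit K v liouville_profile at_top"
    proof (rule uniform_limitI)
      fix \<delta> :: real assume "0 < \<delta>"
      from large small[OF this]
      show "\<forall>\<^sub>F p in at_top. \<forall>t\<in>K. dist (v p t) (liouville_profile t) < \<delta>"
      proof eventually_elim
        case (elim p)
        then show ?case using close[of p] by (force simp: dist_real_def)
      qed
    qed
    show "uniform_limit K (\<lambda>p. deriv (v p)) (deriv liouville_profile) at_top"
    proof (rule uniform_limitI)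
      fix \<delta> :: real assume "0 < \<delta>"
      from large small[OF this]
      show "\<forall>\<^sub>F p in at_top. \<forall>t\<in>K. dist (deriv (v p) t) (deriv liouville_profile t) < \<delta>"
      proof eventually_elim
        case (elim p)
        then have "deriv (v p) t = v1 p t" if "t \<in> K" for t
          using v[of p t] that by (auto intro: DERIV_imp_deriv)
        then show ?case
          using elim close[of p] DERIV_imp_deriv[OF DERIV_liouville_profile]
          by (force simp: dist_real_def)
      qed
    qed
  qed
  ultimately show ?thesis
    by (simp add: v_def[abs_def] T_def rescaled_interval_def liouville_profile_def[abs_def])
qed

end
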